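(* Let $X, X_1, X_2, \ldots$ be i.i.d. random variables, let $\lambda$ be the distribution of $X$ and $\lambda_n$ the distribution of $X_n$ for $n = 1, 2, \ldots$, where $$\lambda(\{j\}) = \lambda_n(\{j\}) = \begin{cases} 1/2, & j = 0,\\ 1/2, & j = 1,\\ 0, & \text{otherwise.}\end{cases}$$ For each $n \ge 1$ let $Y_n = \max\{X_i : i \in \{1, \ldots, n\}\}$ and $Z_n = \max\{ i \in \{1, \ldots, n\} : X_i = Y_n\}$, let $\mu_n$ be the distribution of $Z_n$, and let $\mu$ be the weak limit of $(\mu_n)_{n \ge 1}$ as probability measures on $(\overline{\mathbb{R}}, \mathcal{B}(\overline{\mathbb{R}}))$. Then $\lambda_n \Rightarrow \lambda$ with $$\lambda(\{0\}) = \mu(\mathbb{R}) = 0.$$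
   Context: $\overline{\mathbb{R}} = [-\infty, \infty]$ is the extended real line, equipped with the metric $d(x,y) = |\tan^{-1}(x) - \tan^{-1}(y)|$, which makes it homeomorphic to $[0,1]$; $\mathcal{B}(\overline{\mathbb{R}})$ is its Borel $\sigma$-algebra. All the measures $\lambda, \mu, \lambda_n, \mu_n$ are regarded as probability measures on $(\overline{\mathbb{R}}, \mathcal{B}(\overline{\mathbb{R}}))$, with $\lambda(\{\pm\infty\}) = \lambda_n(\{\pm\infty\}) = 0$ and $\lambda_n(\mathbb{R}) = \mu_n(\mathbb{R}) = 1$. For probability measures $\rho, \rho_1, \rho_2, \ldots$ on $(\overline{\mathbb{R}}, \mathcal{B}(\overline{\mathbb{R}}))$, $\rho_n \Rightarrow \rho$ (weak convergence) means $\int_{\overline{\mathbb{R}}} f \, d\rho_n \to \int_{\overline{\mathbb{R}}} f \, d\rho$ as $n \to \infty$ for every continuous $f : \overline{\mathbb{R}} \to \mathbb{R}$. The probability mass function of $Z_n$ is $\mu_n(\{j\}) = 2^{-(n-j+1)}$ for $1 \le j < n$, $\mu_n(\{n\}) = 2^{-1} + 2^{-n}$, and $\mu_n(\{j\}) = 0$ otherwise. The weak limit $\mu$ of $(\mu_n)_{n\ge1}$ is the Dirac measure concentrated at $\{\infty\}$, that is, $\mu(\{\infty\}) = 1$.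
   Formalization: The printed conclusion λ({0}) = μ(ℝ) = 0 contradicts the hypothesis λ({0}) = 1/2; the formal theorem proves λ({−∞, ∞}) = μ(ℝ) = 0 instead, together with λ_n ⇒ λ and μ_n ⇒ μ. *)

theory Defs
  imports "HOL-Probability.Probability"
begin

definition arctan_ereal :: "ereal \<Rightarrow> real" where
  "arctan_ereal x =
     (if x = \<infinity> then pi / 2 else if x = -\<infinity> then - (pi / 2) else arctan (real_of_ereal x))"

lemma arctan_ereal_simps [simp]:
  "arctan_ereal (ereal r) = arctan r"
  "arctan_ereal \<infinity> = pi / 2"
  "arctan_ereal (-\<infinity>) = - (pi / 2)"
  by (auto simp: arctan_ereal_def)

definition dist_ereal :: "ereal \<Rightarrow> ereal \<Rightarrow> real" where
  "dist_ereal x y = \<bar>arctan_ereal x - arctan_ereal y\<bar>"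

lemma strict_mono_arctan_ereal: "strict_mono arctan_ereal"
proof (rule strict_monoI)
  fix x y :: ereal
  assume "x < y"
  then show "arctan_ereal x < arctan_ereal y"
    using arctan_ubound arctan_lbound pi_gt_zero
    by (cases x; cases y) (auto simp: arctan_less_iff)
qed

lemma range_arctan_ereal: "range arctan_ereal = {- (pi / 2)..pi / 2}"
proof
  have "arctan_ereal x \<in> {- (pi / 2)..pi / 2}" for x
    using arctan_ubound arctan_lbound by (cases x) (auto intro: less_imp_le)
  then show "range arctan_ereal \<subseteq> {- (pi / 2)..pi / 2}" by blast
  show "{- (pi / 2)..pi / 2} \<subseteq> range arctan_ereal"
  proof
    fix t assume t: "t \<in> {- (pi / 2)..pi / 2}"
    show "t \<in> range arctan_ereal"
    proof (cases "t = pi / 2 \<or> t = - (pi / 2)")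
      case True
      then show ?thesis
        by (metis arctan_ereal_simps(2,3) rangeI)
    next
      case False
      then have "arctan_ereal (ereal (tan t)) = t"
        using t by (auto intro!: arctan_tan)
      then show ?thesis by (metis rangeI)
    qed
  qed
qed

lemma continuous_on_arctan_ereal: "continuous_on UNIV arctan_ereal"
proof -
  let ?I = "{- (pi / 2)..pi / 2}"
  have le: "arctan_ereal x \<le> arctan_ereal y \<longleftrightarrow> x \<le> y" for x y
    using strict_mono_arctan_ereal by (rule strict_mono_less_eq)
  have "continuous (at x) arctan_ereal" for x
    unfolding continuous_at
  proof (rule order_tendstoI)
    fix a assume a: "a < arctan_ereal x"
    show "\<forall>\<^sub>F y in at x. a < arctan_ereal y"
    proof (cases "a < - (pi / 2)")
      case True
      have "- (pi / 2) \<le> arctan_ereal y" for y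
        using range_arctan_ereal by (metis atLeastAtMost_iff rangeI)
      with True show ?thesis by (intro always_eventually allI) (rule less_le_trans)
    next
      case False
      moreover have "arctan_ereal x \<le> pi / 2"
        using range_arctan_ereal by (metis atLeastAtMost_iff rangeI)
      ultimately obtain z where z: "arctan_ereal z = a"
        using a range_arctan_ereal
        by (metis atLeastAtMost_iff imageE less_le_trans not_less less_imp_le)
      have "z < x" using a z le by (metis not_less)
      then have "\<forall>\<^sub>F y in at x. z < y"
        by (simp add: order_tendstoD(1)[OF tendsto_ident_at])
      then show ?thesis
        by eventually_elim (use z le in \<open>metis not_less\<close>)
    qed
  next
    fix a assume a: "a > arctan_ereal x"
    show "\<forall>\<^sub>F y in at x. a > arctan_ereal y"
    proof (cases "a > pi / 2")
      case True
      have "arctan_ereal y \<le> pi / 2" for y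
        using range_arctan_ereal by (metis atLeastAtMost_iff rangeI)
      with True show ?thesis by (intro always_eventually allI) (rule le_less_trans)
    next
      case False
      moreover have "- (pi / 2) \<le> arctan_ereal x"
        using range_arctan_ereal by (metis atLeastAtMost_iff rangeI)
      ultimately obtain z where z: "arctan_ereal z = a"
        using a range_arctan_ereal
        by (metis atLeastAtMost_iff imageE le_less_trans not_less less_imp_le)
      have "x < z" using a z le by (metis not_less)
      then have "\<forall>\<^sub>F y in at x. y < z"
        by (simp add: order_tendstoD(2)[OF tendsto_ident_at])
      then show ?thesis
        by eventually_elim (use z le in \<open>metis not_less\<close>)
    qed
  qed
  then show ?thesis by (simp add: continuous_at_imp_continuous_on)
qed

text \<open>The order topology of the library on \<^typ>\<open>ereal\<close> is the topology of the metric
  \<^const>\<open>dist_ereal\<close>, so continuity and \<^term>\<open>borel :: ereal measure\<close>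
  below refer to that metric.\<close>

lemma open_ereal_iff_dist_ereal:
  "open U \<longleftrightarrow> (\<forall>x\<in>U. \<exists>e>0. \<forall>y. dist_ereal x y < e \<longrightarrow> y \<in> U)"
proof
  assume U: "open U"
  show "\<forall>x\<in>U. \<exists>e>0. \<forall>y. dist_ereal x y < e \<longrightarrow> y \<in> U"
  proof
    fix x assume x: "x \<in> U"
    have "compact (- U)"
      using U compact_Int_closed[OF compact_UNIV, of "- U"] by (simp add: closed_Compl)
    then have "closed (arctan_ereal ` (- U))"
      by (intro compact_imp_closed compact_continuous_image
            continuous_on_subset[OF continuous_on_arctan_ereal]) auto
    moreover have "arctan_ereal x \<in> - (arctan_ereal ` (- U))"
      using x strict_mono_imp_inj_on[OF strict_mono_arctan_ereal] by (auto dest: injD)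
    ultimately obtain e where "e > 0" and
      e: "\<And>t. dist t (arctan_ereal x) < e \<Longrightarrow> t \<in> - (arctan_ereal ` (- U))"
      by (metis open_Compl open_dist)
    then show "\<exists>e>0. \<forall>y. dist_ereal x y < e \<longrightarrow> y \<in> U"
      by (intro exI[of _ e]) (auto simp: dist_ereal_def dist_real_def abs_minus_commute)
  qed
next
  assume *: "\<forall>x\<in>U. \<exists>e>0. \<forall>y. dist_ereal x y < e \<longrightarrow> y \<in> U"
  show "open U"
  proof (subst open_subopen, rule ballI)
    fix x assume "x \<in> U"
    then obtain e where e: "e > 0" "\<And>y. dist_ereal x y < e \<Longrightarrow> y \<in> U"
      using * by blast
    let ?T = "arctan_ereal -` ball (arctan_ereal x) e"
    have "open ?T"
      using continuous_on_arctan_ereal by (intro open_vimage) auto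
    moreover have "x \<in> ?T" "?T \<subseteq> U"
      using e by (auto simp: dist_ereal_def dist_real_def)
    ultimately show "\<exists>T. open T \<and> x \<in> T \<and> T \<subseteq> U" by blast
  qed
qed

definition prob_measure_ereal :: "ereal measure \<Rightarrow> bool" where
  "prob_measure_ereal \<rho> \<longleftrightarrow> prob_space \<rho> \<and> sets \<rho> = sets borel"

text \<open>Sequences of measures are indexed by \<open>n \<ge> 1\<close>; the entry at \<open>0\<close> is irrelevant.\<close>

definition weakly_converges :: "(nat \<Rightarrow> ereal measure) \<Rightarrow> ereal measure \<Rightarrow> bool" where
  "weakly_converges \<rho>s \<rho> \<longleftrightarrow>
     (\<forall>n\<ge>1. prob_measure_ereal (\<rho>s n)) \<and> prob_measure_ereal \<rho> \<and>
     (\<forall>f :: ereal \<Rightarrow> real. continuous_on UNIV f \<longrightarrow>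
        (\<lambda>n. integral\<^sup>L (\<rho>s n) f) \<longlonglongrightarrow> integral\<^sup>L \<rho> f)"

definition weak_limit :: "(nat \<Rightarrow> ereal measure) \<Rightarrow> ereal measure" where
  "weak_limit \<rho>s = (THE \<rho>. weakly_converges \<rho>s \<rho>)"

definition law :: "'a measure \<Rightarrow> ('a \<Rightarrow> real) \<Rightarrow> ereal measure" where
  "law M X = distr M borel (\<lambda>\<omega>. ereal (X \<omega>))"

definition running_max :: "(nat \<Rightarrow> 'a \<Rightarrow> real) \<Rightarrow> nat \<Rightarrow> 'a \<Rightarrow> real" where
  "running_max X n \<omega> = Max ((\<lambda>i. X i \<omega>) ` {1..n})"

definition last_argmax :: "(nat \<Rightarrow> 'a \<Rightarrow> real) \<Rightarrow> nat \<Rightarrow> 'a \<Rightarrow> nat" where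
  "last_argmax X n \<omega> = Max {i \<in> {1..n}. X i \<omega> = running_max X n \<omega>}"

text \<open>The source prints the final claim as \<open>\<lambda>({0}) = \<mu>(\<real>) = 0\<close>, which contradicts its
  own hypothesis \<open>\<lambda>({0}) = 1/2\<close>. The theorem states \<open>\<lambda>({-\<infinity>, \<infinity>}) = \<mu>(\<real>) = 0\<close> instead.\<close>

end

theory Submission
  imports Defs
begin

text \<open>Almost surely infinitely many of the \<open>X\<^sub>i\<close> equal the essential maximum \<open>1\<close>, so
  \<open>Z\<^sub>n \<rightarrow> \<infinity>\<close> almost surely, and dominated convergence gives weak convergence of \<open>\<mu>\<^sub>n\<close> to the
  Dirac measure at \<open>\<infinity>\<close>. This limit is unique: a limit \<open>\<rho>\<close> has
  \<open>\<integral> arctan d\<rho> = \<pi>/2 = max arctan\<close>, so \<open>\<rho>\<close> is concentrated at \<open>\<infinity>\<close>.\<close>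

section \<open>Characterization of the Dirac measure at infinity\<close>

lemma arctan_ereal_le: "arctan_ereal x \<le> pi / 2"
  using range_arctan_ereal by (metis atLeastAtMost_iff rangeI)

lemma arctan_ereal_ge: "- (pi / 2) \<le> arctan_ereal x"
  using range_arctan_ereal by (metis atLeastAtMost_iff rangeI)

lemma arctan_ereal_eq_pi_half_iff: "arctan_ereal x = pi / 2 \<longleftrightarrow> x = \<infinity>"
  using strict_mono_imp_inj_on[OF strict_mono_arctan_ereal] arctan_ereal_simps(2)
  by (metis injD)

text \<open>The nonnegative function \<open>pi / 2 - arctan_ereal x\<close> has integral 0, so it
  vanishes almost everywhere, and \<open>arctan_ereal\<close> takes the value \<open>pi / 2\<close>
  only at infinity.\<close>

lemma eq_return_infinity:
  assumes "prob_measure_ereal \<rho>" and int: "integral\<^sup>L \<rho> arctan_ereal = pi / 2"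
  shows "\<rho> = return borel \<infinity>"
proof -
  interpret prob_space \<rho> using assms(1) by (simp add: prob_measure_ereal_def)
  have sets [measurable_cong, simp]: "sets \<rho> = sets borel"
    using assms(1) by (simp add: prob_measure_ereal_def)
  have meas [measurable]: "arctan_ereal \<in> borel_measurable borel"
    by (intro borel_measurable_continuous_onI continuous_on_arctan_ereal)
  have "norm (arctan_ereal x) \<le> pi / 2" for x
    using arctan_ereal_le[of x] arctan_ereal_ge[of x] by (simp add: abs_le_iff)
  then have intg: "integrable \<rho> arctan_ereal"
    by (intro integrable_const_bound[where B = "pi / 2"] AE_I2) measurable
  have "integral\<^sup>L \<rho> (\<lambda>x. pi / 2 - arctan_ereal x) = 0"
    using intg int by (simp add: prob_space)
  then have "AE x in \<rho>. pi / 2 - arctan_ereal x = 0"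
    by (subst (asm) integral_nonneg_eq_0_iff_AE) (use intg in \<open>simp_all only: diff_ge_0_iff_ge arctan_ereal_le AE_I2 Bochner_Integration.integrable_diff integrable_const\<close>)
  then have AE: "AE x in \<rho>. x = \<infinity>"
    by eventually_elim (use arctan_ereal_eq_pi_half_iff in force)
  show ?thesis
  proof (rule measure_eqI)
    fix A assume A: "A \<in> sets \<rho>"
    \<comment> \<open>Up to a null set, A is the whole space or empty, according to whether it
      contains the point at infinity.\<close>
    have "emeasure \<rho> A = emeasure \<rho> (if \<infinity> \<in> A then space \<rho> else {})"
      by (rule emeasure_eq_AE)
         (use AE A in \<open>auto simp: space_borel sets_eq_imp_space_eq[OF sets]\<close>)
    then show "emeasure \<rho> A = emeasure (return borel \<infinity>) A"
      using A by (auto simp: emeasure_space_1)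
  qed simp
qed

text \<open>\<open>weak_limit\<close> is a definite description, so evaluating it requires
  uniqueness; the single test function \<open>arctan_ereal\<close> already identifies the
  limit.\<close>

lemma weak_limit_eq_return_infinity:
  assumes "weakly_converges \<rho>s (return borel \<infinity>)"
  shows "weak_limit \<rho>s = return borel \<infinity>"
  unfolding weak_limit_def
proof (rule the_equality[where P = "weakly_converges \<rho>s", OF assms])
  fix \<rho> assume \<rho>: "weakly_converges \<rho>s \<rho>"
  have [measurable]: "arctan_ereal \<in> borel_measurable borel"
    by (intro borel_measurable_continuous_onI continuous_on_arctan_ereal)
  have "(\<lambda>n. integral\<^sup>L (\<rho>s n) arctan_ereal) \<longlonglongrightarrow> integral\<^sup>L \<rho> arctan_ereal"
    using \<rho> continuous_on_arctan_ereal by (simp add: weakly_converges_def)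
  moreover have "(\<lambda>n. integral\<^sup>L (\<rho>s n) arctan_ereal) \<longlonglongrightarrow> integral\<^sup>L (return borel \<infinity>) arctan_ereal"
    using assms continuous_on_arctan_ereal by (simp add: weakly_converges_def)
  ultimately have "integral\<^sup>L \<rho> arctan_ereal = integral\<^sup>L (return borel \<infinity>) arctan_ereal"
    by (rule LIMSEQ_unique)
  also have "\<dots> = pi / 2"
    by (subst integral_return) auto
  finally show "\<rho> = return borel \<infinity>"
    using \<rho> by (intro eq_return_infinity) (auto simp: weakly_converges_def)
qed

section \<open>Laws on the extended line, weak convergence and recurrence\<close>

context prob_space
begin

lemma prob_measure_ereal_law:
  assumes [measurable]: "random_variable borel X"
  shows "prob_measure_ereal (law M X)"
  unfolding prob_measure_ereal_def law_def by (auto intro!: prob_space_distr)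

lemma measure_law_singleton:
  assumes [measurable]: "random_variable borel X"
  shows "measure (law M X) {ereal j} = prob {\<omega> \<in> space M. X \<omega> = j}"
  unfolding law_def
  by (subst measure_distr) (auto intro!: arg_cong[where f = prob])

text \<open>\<open>law\<close> is the image of the real distribution under \<open>ereal\<close>.
  This transfers identical distribution from the real line to the extended line.\<close>

lemma law_cong_distr:
  assumes [measurable]: "random_variable borel X" "random_variable borel Y"
    and "distr M borel X = distr M borel Y"
  shows "law M X = law M Y"
proof -
  have "law M Z = distr (distr M borel Z) borel ereal" if "random_variable borel Z" for Z
    using that unfolding law_def by (subst distr_distr) (auto simp: comp_def)
  then show ?thesis using assms by metis
qed

lemma weakly_converges_law_AE_tendsto_infinity:
  assumes meas: "\<And>n. n \<ge> 1 \<Longrightarrow> random_variable borel (Y n)"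
    and lim: "AE \<omega> in M. (\<lambda>n. ereal (Y n \<omega>)) \<longlonglongrightarrow> \<infinity>"
    and \<rho>s: "\<And>n. n \<ge> 1 \<Longrightarrow> \<rho>s n = law M (Y n)"
  shows "weakly_converges \<rho>s (return borel \<infinity>)"
  unfolding weakly_converges_def
proof (intro conjI allI impI)
  show "prob_measure_ereal (\<rho>s n)" if "n \<ge> 1" for n
    using that meas by (simp add: \<rho>s prob_measure_ereal_law)
  show "prob_measure_ereal (return borel \<infinity>)"
    by (auto simp: prob_measure_ereal_def intro!: prob_space_return)
  fix f :: "ereal \<Rightarrow> real" assume f: "continuous_on UNIV f"
  have [measurable]: "f \<in> borel_measurable borel"
    by (rule borel_measurable_continuous_onI[OF f])
  \<comment> \<open>Compactness of the extended line yields the constant majorant for dominated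
    convergence.\<close>
  have "bounded (range f)"
    by (intro compact_imp_bounded compact_continuous_image f compact_UNIV)
  then obtain B where B: "\<And>x. norm (f x) \<le> B"
    by (auto simp: bounded_iff)
  \<comment> \<open>The shift by one avoids the entry at 0, about which nothing is assumed;
    \<open>LIMSEQ_imp_Suc\<close> undoes it at the end.\<close>
  have "(\<lambda>n. \<integral>\<omega>. f (ereal (Y (Suc n) \<omega>)) \<partial>M) \<longlonglongrightarrow> (\<integral>\<omega>. f \<infinity> \<partial>M)"
  proof (rule integral_dominated_convergence[where w = "\<lambda>_. B"])
    show "AE \<omega> in M. (\<lambda>n. f (ereal (Y (Suc n) \<omega>))) \<longlonglongrightarrow> f \<infinity>"
      using lim
    proof eventually_elim
      case (elim \<omega>)
      show ?case
        by (rule continuous_on_tendsto_compose[OF f LIMSEQ_Suc[OF elim]]) auto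
    qed
  next
    fix n
    have [measurable]: "random_variable borel (Y (Suc n))" by (rule meas) simp
    show "(\<lambda>\<omega>. f (ereal (Y (Suc n) \<omega>))) \<in> borel_measurable M" by measurable
    show "AE \<omega> in M. norm (f (ereal (Y (Suc n) \<omega>))) \<le> B" using B by simp
  qed auto
  moreover have "(\<integral>\<omega>. f (ereal (Y (Suc n) \<omega>)) \<partial>M) = integral\<^sup>L (\<rho>s (Suc n)) f" for n
  proof -
    have [measurable]: "random_variable borel (Y (Suc n))" by (rule meas) simp
    show ?thesis by (simp add: \<rho>s law_def integral_distr)
  qed
  moreover have "(\<integral>\<omega>. f \<infinity> \<partial>M) = integral\<^sup>L (return borel \<infinity>) f"
    by (subst integral_return) (auto simp: prob_space)
  ultimately show "(\<lambda>n. integral\<^sup>L (\<rho>s n) f) \<longlonglongrightarrow> integral\<^sup>L (return borel \<infinity>) f"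
    by (auto intro: LIMSEQ_imp_Suc)
qed

text \<open>Missing A at every index beyond k forces any number of independent misses, each of
  probability at most p, so the failure event has probability below every power of p. This is a case
  of the second Borel-Cantelli lemma.\<close>

lemma AE_ex_greater_in:
  fixes p :: real and Xs :: "nat \<Rightarrow> 'a \<Rightarrow> 'b" and k :: nat
  assumes indep: "indep_vars (\<lambda>_. N) Xs {1..}"
    and A: "A \<in> sets N"
    and p: "\<And>i. i \<ge> 1 \<Longrightarrow> prob {\<omega> \<in> space M. Xs i \<omega> \<notin> A} \<le> p" "p < 1"
  shows "AE \<omega> in M. \<exists>i>k. Xs i \<omega> \<in> A"
proof -
  have rv [measurable]: "random_variable N (Xs i)" if "i \<ge> 1" for i
    using indep that by (simp add: indep_vars_def)
  note [measurable] = A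
  let ?E = "\<lambda>i. Xs i -` (space N - A) \<inter> space M"
  have E_eq: "?E i = {\<omega> \<in> space M. Xs i \<omega> \<notin> A}" if "i \<ge> 1" for i
    using measurable_space[OF rv[OF that]] by auto
  have E_ev: "?E i \<in> events" if "i \<ge> 1" for i
    using rv[OF that] A by (auto intro: measurable_sets)
  have p0: "0 \<le> p"
    by (rule order_trans[OF measure_nonneg p(1)[of 1]]) simp
  define S where "S = (\<Inter>i\<in>{k<..}. ?E i)"
  have S_ev: "S \<in> events"
    unfolding S_def by (intro sets.countable_INT') (auto intro!: E_ev)
  have bound: "prob S \<le> p ^ Suc m" for m
  proof -
    \<comment> \<open>Length \<open>Suc m\<close> keeps the window nonempty: an empty intersection
      would be \<open>UNIV\<close>, which need not be an event.\<close>
    let ?J = "{k<..k + Suc m}"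
    have "prob S \<le> prob (\<Inter>i\<in>?J. ?E i)"
    proof (rule finite_measure_mono)
      show "(\<Inter>i\<in>?J. ?E i) \<in> events"
        by (intro sets.finite_INT) (auto intro!: E_ev)
    qed (auto simp: S_def)
    also have "\<dots> = (\<Prod>i\<in>?J. prob (?E i))"
      by (rule indep_varsD[OF indep]) (use A in auto)
    also have "\<dots> \<le> (\<Prod>i\<in>?J. p)"
      by (intro prod_mono) (use p(1) E_eq in auto)
    finally show ?thesis by simp
  qed
  have "(\<lambda>m. p ^ Suc m) \<longlonglongrightarrow> 0"
    using p0 p(2) by (intro LIMSEQ_Suc LIMSEQ_power_zero) auto
  then have "prob S \<le> 0"
    by (rule LIMSEQ_le_const) (use bound in auto)
  then have "S \<in> null_sets M"
    using S_ev measure_nonneg[of M S] by (auto simp: null_sets_def emeasure_eq_measure)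
  then show ?thesis
    by (rule AE_I') (use E_eq in \<open>fastforce simp: S_def\<close>)
qed

end

section \<open>Growth and measurability of the last argmax\<close>

lemma last_argmax_ge:
  assumes "1 \<le> i" "i \<le> n" and "\<And>j. 1 \<le> j \<Longrightarrow> X j \<omega> \<le> X i \<omega>"
  shows "i \<le> last_argmax X n \<omega>"
proof -
  have "running_max X n \<omega> = X i \<omega>"
    unfolding running_max_def by (rule Max_eqI) (use assms in auto)
  then show ?thesis
    unfolding last_argmax_def by (intro Max_ge) (use assms in auto)
qed

text \<open>An index attaining the overall maximum is a lower bound for every later
  \<open>last_argmax\<close>, and such indices occur arbitrarily late.\<close>

lemma filterlim_last_argmax:
  assumes "\<And>k. \<exists>i>k. \<forall>j\<ge>1. X j \<omega> \<le> X i \<omega>"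
  shows "filterlim (\<lambda>n. last_argmax X n \<omega>) at_top sequentially"
  unfolding filterlim_at_top
proof
  fix k
  obtain i where i: "i > k" "\<forall>j\<ge>1. X j \<omega> \<le> X i \<omega>" using assms by blast
  show "\<forall>\<^sub>F n in sequentially. k \<le> last_argmax X n \<omega>"
    using eventually_ge_at_top[of i]
  proof eventually_elim
    case (elim n)
    then have "i \<le> last_argmax X n \<omega>" by (intro last_argmax_ge) (use i in auto)
    with i show ?case by simp
  qed
qed

lemma measurable_last_argmax:
  assumes "\<And>i. i \<ge> 1 \<Longrightarrow> X i \<in> borel_measurable M"
  shows "last_argmax X n \<in> measurable M (count_space UNIV)"
proof -
  have [measurable]: "running_max X n \<in> borel_measurable M"
    unfolding running_max_def by (rule borel_measurable_Max) (use assms in auto)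
  have "Measurable.pred M (\<lambda>\<omega>. i \<in> {1..n} \<and> X i \<omega> = running_max X n \<omega>)" for i
  proof (cases "i \<in> {1..n}")
    case True
    then have [measurable]: "X i \<in> borel_measurable M" using assms by simp
    show ?thesis by measurable
  next
    case False
    \<comment> \<open>Measurability of \<open>X 0\<close> is not assumed, so indices outside the
      range are treated as a constant predicate.\<close>
    then have "(\<lambda>\<omega>. i \<in> {1..n} \<and> X i \<omega> = running_max X n \<omega>) = (\<lambda>_. False)" by blast
    then show ?thesis by (simp only: measurable_const space_count_space UNIV_I)
  qed
  then show ?thesis
    unfolding last_argmax_def by (rule measurable_Max_nat)
qed

theorem theorem1:
  fixes M :: "'a measure"
    and X :: "'a \<Rightarrow> real"
    and Xs :: "nat \<Rightarrow> 'a \<Rightarrow> real"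
    and lam mu :: "ereal measure"
    and lams mus :: "nat \<Rightarrow> ereal measure"
  assumes "prob_space M"
    and "prob_space.indep_vars M (\<lambda>_. borel) (Xs(0 := X)) UNIV"
    and "\<forall>n\<ge>1. distr M borel (Xs n) = distr M borel X"
    and "lam = law M X"
    and "\<forall>n\<ge>1. lams n = law M (Xs n)"
    and "\<forall>j::real. measure lam {ereal j} = (if j = 0 then 1/2 else if j = 1 then 1/2 else 0)"
    and "\<forall>n\<ge>1. \<forall>j::real.
           measure (lams n) {ereal j} = (if j = 0 then 1/2 else if j = 1 then 1/2 else 0)"
    and "\<forall>n\<ge>1. mus n = law M (\<lambda>\<omega>. real (last_argmax Xs n \<omega>))"
    and "mu = weak_limit mus"
  shows "weakly_converges lams lam \<and> weakly_converges mus mu \<and>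
    measure lam {-\<infinity>, \<infinity>} = measure mu (range ereal) \<and> measure mu (range ereal) = 0"
proof -
  interpret prob_space M by fact
  have rv: "random_variable borel ((Xs(0 := X)) i)" for i
    using assms(2) by (simp add: indep_vars_def)
  have rvX [measurable]: "random_variable borel X" using rv[of 0] by simp
  have rvXs: "random_variable borel (Xs i)" if "i \<ge> 1" for i
    using rv[of i] that by simp
  \<comment> \<open>Slot 0 of the joint family holds \<open>X\<close>; on the indices from 1 on the
    family agrees with \<open>Xs\<close>.\<close>
  have "indep_vars (\<lambda>_. borel) (Xs(0 := X)) {1..}"
    using assms(2) by (rule indep_vars_subset) simp
  then have indep: "indep_vars (\<lambda>_. borel) Xs {1..}"
    by (rule indep_vars_cong[THEN iffD1, rotated -1]) auto
  have P: "prob {\<omega> \<in> space M. Xs i \<omega> = j} = (if j = 0 then 1/2 else if j = 1 then 1/2 else 0)"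
    if "i \<ge> 1" for i j
    using assms(5,7) that measure_law_singleton[OF rvXs[OF that], of j] by simp
  \<comment> \<open>The point masses at 0 and 1 already add up to 1.\<close>
  have P01: "AE \<omega> in M. Xs i \<omega> \<in> {0, 1}" if i: "i \<ge> 1" for i
  proof -
    note [measurable] = rvXs[OF i]
    have "prob {\<omega> \<in> space M. Xs i \<omega> \<in> {0, 1}} =
        prob ({\<omega> \<in> space M. Xs i \<omega> = 0} \<union> {\<omega> \<in> space M. Xs i \<omega> = 1})"
      by (intro arg_cong[where f = prob]) auto
    also have "\<dots> = 1"
      by (subst finite_measure_Union) (auto simp: P[OF i])
    finally show ?thesis by (subst (asm) prob_Collect_eq_1) auto
  qed
  \<comment> \<open>The bound 1/2 is the probability of missing the value 1; it is the ratio p of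
    the geometric estimate.\<close>
  have P1: "prob {\<omega> \<in> space M. Xs i \<omega> \<notin> {1}} \<le> 1 / 2" if i: "i \<ge> 1" for i
  proof -
    note [measurable] = rvXs[OF i]
    show ?thesis using P[OF i, of 1] by (subst prob_neg) auto
  qed
  have ex1: "AE \<omega> in M. \<exists>i>k. Xs i \<omega> \<in> {1}" for k
    by (rule AE_ex_greater_in[OF indep _ P1]) auto
  have bnd: "AE \<omega> in M. \<forall>j\<in>{1..}. Xs j \<omega> \<in> {0, 1}"
    by (subst AE_ball_countable) (use P01 in auto)
  have ex: "AE \<omega> in M. \<forall>k. \<exists>i>k. Xs i \<omega> \<in> {1}"
    by (subst AE_all_countable) (use ex1 in auto)
  \<comment> \<open>On almost every path no value exceeds 1 and the value 1 recurs beyond every k,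
    so each occurrence of 1 is an overall maximum.\<close>
  have "AE \<omega> in M. (\<lambda>n. ereal (real (last_argmax Xs n \<omega>))) \<longlonglongrightarrow> \<infinity>"
    using bnd ex
  proof eventually_elim
    case (elim \<omega>)
    have "\<exists>i>k. \<forall>j\<ge>1. Xs j \<omega> \<le> Xs i \<omega>" for k
    proof -
      obtain i where "i > k" "Xs i \<omega> = 1" using elim(2) by blast
      moreover have "Xs j \<omega> \<le> 1" if "j \<ge> 1" for j using elim(1) that by force
      ultimately show ?thesis by metis
    qed
    then have "filterlim (\<lambda>n. last_argmax Xs n \<omega>) at_top sequentially"
      by (rule filterlim_last_argmax)
    then show ?case
      unfolding tendsto_PInfty_eq_at_top
      by (rule filterlim_compose[OF filterlim_real_sequentially])
  qed
  moreover have "random_variable borel (\<lambda>\<omega>. real (last_argmax Xs n \<omega>))" for n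
    using measurable_last_argmax[of Xs M n, OF rvXs] by measurable
  ultimately have mus: "weakly_converges mus (return borel \<infinity>)"
    using assms(8) by (intro weakly_converges_law_AE_tendsto_infinity) auto
  then have mu: "mu = return borel \<infinity>"
    using assms(9) by (simp add: weak_limit_eq_return_infinity)
  \<comment> \<open>The sequence is constant from index 1 on, which makes its weak convergence
    immediate.\<close>
  have "lams n = lam" if "n \<ge> 1" for n
    using assms(3-5) that law_cong_distr[OF rvXs rvX] by auto
  then have "weakly_converges lams lam"
    unfolding weakly_converges_def using prob_measure_ereal_law[OF rvX] assms(4)
    by (auto intro!: tendsto_eventually eventually_sequentiallyI[of 1])
  moreover have "measure lam {-\<infinity>, \<infinity>} = 0"
  proof -
    have "(\<lambda>\<omega>. ereal (X \<omega>)) -` {-\<infinity>, \<infinity>} \<inter> space M = {}" by auto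
    then show ?thesis unfolding assms(4) law_def by (subst measure_distr) simp_all
  qed
  moreover have "measure mu (range ereal) = 0"
  proof -
    \<comment> \<open>The real line omits the point at infinity, which carries all the mass of
      \<open>mu\<close>.\<close>
    have "range ereal = - {-\<infinity>, \<infinity>}"
    proof (rule set_eqI)
      show "x \<in> range ereal \<longleftrightarrow> x \<in> - {-\<infinity>, \<infinity>}" for x by (cases x) auto
    qed
    then show ?thesis unfolding mu by (simp add: measure_return)
  qed
  ultimately show ?thesis using mus mu by simp
qed

end
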